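(* Let $K\subset\mathbb{R}^d$ be a full-dimensional convex body such that the Euclidean unit ball $\mathbb{B}_2$ is the ellipsoid of maximal volume contained in $K$. Then the smallest $\rho\ge 0$ with $K\subset\rho\,\mathbb{B}_2$ satisfies $$s(K)\le\rho\le\sqrt{s_0(K)\,d}.$$
   Context: A convex body is a non-empty compact convex set; $\mathbb{B}_2=\{x\in\mathbb{R}^d:\|x\|_2\le1\}$. Every full-dimensional convex body $K$ contains a unique ellipsoid of maximal volume; let $c_K$ denote its center. - Minkowski asymmetry: $s(K):=\inf\{\rho\ge0:\exists c\in\mathbb{R}^d\text{ such that }-K\subset c+\rho K\}$. - John asymmetry: $s_0(K):=\min\{\rho\ge0: -(K-c_K)\subset\rho(K-c_K)\}$. *)

theory Defs
  imports "HOL-Analysis.Analysis"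
begin

definition convex_body :: "(real ^ 'n) set \<Rightarrow> bool" where
  "convex_body K \<longleftrightarrow> K \<noteq> {} \<and> compact K \<and> convex K"

definition full_dimensional :: "(real ^ 'n) set \<Rightarrow> bool" where
  "full_dimensional K \<longleftrightarrow> aff_dim K = int CARD('n)"

text \<open>Ellipsoids are images of the closed Euclidean unit ball under invertible affine maps;
  invertibility of the matrix is required wherever \<open>ellipsoid\<close> is used below.\<close>

definition ellipsoid :: "real ^ 'n \<Rightarrow> real ^ 'n ^ 'n \<Rightarrow> (real ^ 'n) set" where
  "ellipsoid c A = (\<lambda>x. c + A *v x) ` cball 0 1"

definition is_ellipsoid :: "(real ^ 'n) set \<Rightarrow> bool" where
  "is_ellipsoid E \<longleftrightarrow> (\<exists>c A. invertible A \<and> E = ellipsoid c A)"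

text \<open>Uniqueness is not part of this predicate: for a full-dimensional convex body it is
  a theorem that exactly one such \<open>E\<close> exists.\<close>

definition max_volume_ellipsoid :: "(real ^ 'n) set \<Rightarrow> (real ^ 'n) set \<Rightarrow> bool" where
  "max_volume_ellipsoid K E \<longleftrightarrow>
     is_ellipsoid E \<and> E \<subseteq> K \<and>
     (\<forall>F. is_ellipsoid F \<and> F \<subseteq> K \<longrightarrow> measure lebesgue F \<le> measure lebesgue E)"

text \<open>The center $c_K$ of the maximal volume ellipsoid; meaningful for full-dimensional
  convex bodies, where that ellipsoid exists and is unique.\<close>

definition john_center :: "(real ^ 'n) set \<Rightarrow> real ^ 'n" where
  "john_center K = (THE c. \<exists>A. invertible A \<and> max_volume_ellipsoid K (ellipsoid c A))"

definition minkowski_asymmetry :: "(real ^ 'n) set \<Rightarrow> real" where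
  "minkowski_asymmetry K =
     Inf {\<rho>. 0 \<le> \<rho> \<and> (\<exists>c. uminus ` K \<subseteq> (\<lambda>x. c + \<rho> *\<^sub>R x) ` K)}"

text \<open>The minimum is attained for full-dimensional convex bodies, since \<open>K\<close> is compact
  and contains its center in its interior.\<close>

definition john_asymmetry :: "(real ^ 'n) set \<Rightarrow> real" where
  "john_asymmetry K =
     (LEAST \<rho>. 0 \<le> \<rho> \<and>
        uminus ` ((\<lambda>x. x - john_center K) ` K) \<subseteq> (\<lambda>x. \<rho> *\<^sub>R x) ` ((\<lambda>x. x - john_center K) ` K))"

end

theory Submission
  imports Defs
begin

text \<open>Write \<open>d\<close> for the dimension and let \<open>B\<close> be the unit ball, the ellipsoid of maximal volume in \<open>K\<close>.

The lower bound only needs \<open>B \<subseteq> K \<subseteq> \<rho> B\<close>: then \<open>-K \<subseteq> \<rho> B \<subseteq> \<rho> K\<close>.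

For the upper bound, the classical argument takes John's decomposition of the identity by contact
points \<open>u\<close> with weights \<open>w\<close> and sums \<open>w (1 - \<langle>x,u\<rangle>) (s + \<langle>x,u\<rangle>) \<ge> 0\<close>. The proof below uses the
maximality of \<open>B\<close> directly instead. Let \<open>x\<close> be a point of \<open>K\<close> of maximal norm \<open>\<rho>\<close>, and \<open>s\<close> the John
asymmetry. Once the John center is known to be the origin, \<open>-x/s\<close> lies in \<open>K\<close>, so \<open>K\<close> contains
\<open>B\<close> and two points \<open>R e\<close> and \<open>-R' e\<close> on one axis, with \<open>R R' = \<rho>\<^sup>2/s\<close> (or more, if \<open>R'\<close> has to be
raised to \<open>1\<close>). The spheroids around this axis that are inscribed in the convex hull of \<open>B\<close> and these
two points form an explicit one-parameter family starting at \<open>B\<close>, and their volume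
increases at \<open>B\<close> as soon as \<open>R R' > d\<close> (\<open>exists_large_ellipsoid_two_points\<close>). Maximality of
\<open>B\<close> therefore forces \<open>\<rho>\<^sup>2 \<le> s d\<close>.

That the John center is the origin is the uniqueness of the maximal ellipsoid. Let \<open>c + A B\<close> be
another one, so that \<open>\<bar>det A\<bar> = 1\<close>. Multiplying \<open>A\<close> on the right by an orthogonal matrix does not
change the ellipsoid, and by Gram-Schmidt this makes \<open>A\<close> triangular with positive diagonal. The average
of \<open>A\<close> with the identity also gives an ellipsoid in \<open>K\<close>; its determinant is the product of
\<open>(1 + A\<^sub>i\<^sub>i) / 2\<close>, which exceeds \<open>1\<close> by the arithmetic-geometric mean inequality unless all
\<open>A\<^sub>i\<^sub>i\<close> are \<open>1\<close>; by maximality they are. Since the order of the coordinates in Gram-Schmidt is free, this makes every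
row of the original \<open>A\<close> a unit vector, and then the triangular form is the identity: the second ellipsoid is a
translate \<open>c + B\<close> (\<open>ellipsoid_eq_cball_of_max\<close>). If \<open>c\<close> were nonzero, the ball could be stretched
inside the capsule spanned by \<open>B\<close> and \<open>c + B\<close>.\<close>

section \<open>Volumes of linear images\<close>

lemma det_matrix_shear:
  fixes m n :: "'n::finite"
  assumes "m \<noteq> n"
  shows "det (matrix (\<lambda>x::real^'n. \<chi> i. if i = m then x$m + x$n else x$i)) = 1"
proof -
  have "matrix (\<lambda>x::real^'n. \<chi> i. if i = m then x$m + x$n else x$i) =
      (\<chi> k. if k = m then row m (mat 1) + 1 *s row n (mat 1) else row k (mat 1))"
    by (auto simp: vec_eq_iff matrix_def row_def mat_def axis_def)
  then show ?thesis
    using det_row_operation[OF assms, of "mat 1 :: real^'n^'n" 1] by simp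
qed

text \<open>Translating the box to one with corner at the origin meets the sign condition of
\<open>measure_shear_interval\<close>.\<close>

lemma measure_shear_cbox:
  fixes m n :: "'n::finite"
  assumes "m \<noteq> n"
  defines "h \<equiv> \<lambda>x::real^'n. \<chi> i. if i = m then x$m + x$n else x$i"
  shows "measure lebesgue (h ` cbox a b) = measure lebesgue (cbox a b)"
proof (cases "cbox a b = {}")
  case False
  have box: "cbox a b = (+) a ` cbox 0 (b - a)"
    by (simp add: cbox_translation[symmetric])
  have "h ` cbox a b = (+) (h a) ` h ` cbox 0 (b - a)"
    unfolding box image_image h_def by (intro image_cong) (auto simp: vec_eq_iff)
  moreover have "measure lebesgue (h ` cbox 0 (b - a)) = measure lebesgue (cbox 0 (b - a))"
    unfolding h_def using False box by (intro measure_shear_interval assms) auto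
  ultimately show ?thesis
    by (simp only: measure_translation box)
qed simp

lemma measure_transposition_cbox:
  fixes m n :: "'n::finite"
  defines "h \<equiv> \<lambda>x::real^'n. \<chi> i. x $ Transposition.transpose m n i"
  shows "measure lebesgue (h ` cbox a b) = measure lebesgue (cbox a b)"
proof (cases "cbox a b = {}")
  case False
  have hh: "h (h x) = x" for x
    by (simp add: h_def vec_eq_iff)
  have mem: "h x \<in> cbox (h y) (h z)" if "x \<in> cbox y z" for x y z
    using that by (simp add: h_def mem_box_cart)
  have "x \<in> h ` cbox a b" if "x \<in> cbox (h a) (h b)" for x
    using mem[OF that] hh by (intro image_eqI[of _ _ "h x"]) simp_all
  then have img: "h ` cbox a b = cbox (h a) (h b)"
    using mem by blast
  then have "cbox (h a) (h b) \<noteq> {}"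
    using False by blast
  then show ?thesis
    using False prod.permute[OF permutes_swap_id[of m UNIV n], of "\<lambda>i. b$i - a$i"]
    by (simp only: img) (simp add: content_cbox_cart h_def o_def)
qed simp

lemma det_matrix_transposition:
  fixes m n :: "'n::finite"
  shows "\<bar>det (matrix (\<lambda>x::real^'n. \<chi> i. x $ Transposition.transpose m n i))\<bar> = 1"
proof -
  have "matrix (\<lambda>x::real^'n. \<chi> i. x $ Transposition.transpose m n i) =
      (\<chi> i. (mat 1 :: real^'n^'n) $ Transposition.transpose m n i)"
    by (auto simp: vec_eq_iff matrix_def mat_def axis_def)
  then show ?thesis
    using det_permute_rows[OF permutes_swap_id[of m UNIV n], of "mat 1 :: real^'n^'n"]
    by (simp add: sign_swap_id abs_mult)
qed

text \<open>Every linear map is a composition of maps into a coordinate hyperplane, stretches,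
transpositions and shears, and a linear map that scales the volume of boxes by some factor scales that of all measurable sets by it.
The index type carries no order, so a shear is not a triangular matrix here; its determinant is
found by reading it as a row operation.\<close>

lemma measure_linear_image_det:
  fixes f :: "real^'n \<Rightarrow> real^'n"
  assumes "linear f" "S \<in> lmeasurable"
  shows "f ` S \<in> lmeasurable \<and> measure lebesgue (f ` S) = \<bar>det (matrix f)\<bar> * measure lebesgue S"
proof -
  have "\<forall>S\<in>lmeasurable. f ` S \<in> lmeasurable \<and>
      measure lebesgue (f ` S) = \<bar>det (matrix f)\<bar> * measure lebesgue S"
  proof (rule induct_linear_elementary[OF \<open>linear f\<close>]; intro ballI)
    fix f g :: "real^'n \<Rightarrow> real^'n" and S :: "(real^'n) set"
    assume "linear f" "linear g" "S \<in> lmeasurable"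
      and "\<forall>S\<in>lmeasurable. f ` S \<in> lmeasurable \<and>
        measure lebesgue (f ` S) = \<bar>det (matrix f)\<bar> * measure lebesgue S"
      and "\<forall>S\<in>lmeasurable. g ` S \<in> lmeasurable \<and>
        measure lebesgue (g ` S) = \<bar>det (matrix g)\<bar> * measure lebesgue S"
    moreover have "(f \<circ> g) ` S = f ` g ` S"
      by auto
    ultimately show "(f \<circ> g) ` S \<in> lmeasurable \<and>
        measure lebesgue ((f \<circ> g) ` S) = \<bar>det (matrix (f \<circ> g))\<bar> * measure lebesgue S"
      by (simp add: matrix_compose det_mul abs_mult del: o_apply)
  next
    fix f :: "real^'n \<Rightarrow> real^'n" and i and S :: "(real^'n) set"
    assume "linear f" and 0: "\<And>x. f x $ i = 0"
    have "f x \<noteq> axis i 1" for x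
      using 0[of x] by auto
    then have "\<not> inj f"
      using linear_injective_imp_surjective[OF \<open>linear f\<close>] surjD[of f "axis i 1"] by force
    then have "det (matrix f) = 0" "negligible (f ` S)"
      using det_nz_iff_inj[OF \<open>linear f\<close>] negligible_linear_singular_image[OF \<open>linear f\<close>] by auto
    then show "f ` S \<in> lmeasurable \<and> measure lebesgue (f ` S) = \<bar>det (matrix f)\<bar> * measure lebesgue S"
      by (simp add: negligible_iff_measure)
  next
    fix c :: "'n \<Rightarrow> real" and S :: "(real^'n) set"
    assume "S \<in> lmeasurable"
    moreover have "det (matrix (\<lambda>x::real^'n. \<chi> i. c i * x$i)) = prod c UNIV"
      by (subst det_diagonal) (auto simp: matrix_def axis_def)
    ultimately show "(\<lambda>x. \<chi> i. c i * x$i) ` S \<in> lmeasurable \<and>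
        measure lebesgue ((\<lambda>x. \<chi> i. c i * x$i) ` S) =
        \<bar>det (matrix (\<lambda>x::real^'n. \<chi> i. c i * x$i))\<bar> * measure lebesgue S"
      by (simp add: measurable_stretch measure_stretch)
  next
    fix m n :: 'n and S :: "(real^'n) set"
    let ?h = "\<lambda>x::real^'n. \<chi> i. x $ Transposition.transpose m n i"
    assume "S \<in> lmeasurable"
    moreover have "linear ?h"
      by (rule linearI) (simp_all add: vec_eq_iff)
    ultimately show "?h ` S \<in> lmeasurable \<and>
        measure lebesgue (?h ` S) = \<bar>det (matrix ?h)\<bar> * measure lebesgue S"
      using measure_linear_sufficient[of ?h S 1] measure_transposition_cbox[of m n]
        det_matrix_transposition[of m n] by simp
  next
    fix m n :: 'n and S :: "(real^'n) set"
    let ?h = "\<lambda>x::real^'n. \<chi> i. if i = m then x$m + x$n else x$i"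
    assume "m \<noteq> n" "S \<in> lmeasurable"
    moreover have "linear ?h"
      by (rule linearI) (simp_all add: vec_eq_iff algebra_simps)
    ultimately show "?h ` S \<in> lmeasurable \<and>
        measure lebesgue (?h ` S) = \<bar>det (matrix ?h)\<bar> * measure lebesgue S"
      using measure_linear_sufficient[of ?h S 1] measure_shear_cbox[OF \<open>m \<noteq> n\<close>]
        det_matrix_shear[OF \<open>m \<noteq> n\<close>] by (simp del: if_image_distrib)
  qed
  with assms show ?thesis
    by blast
qed

lemma measure_ellipsoid:
  fixes A :: "real^'n^'n"
  shows "measure lebesgue (ellipsoid c A) = \<bar>det A\<bar> * measure lebesgue (cball (0::real^'n) 1)"
proof -
  have "ellipsoid c A = (+) c ` (*v) A ` cball 0 1"
    by (simp add: ellipsoid_def image_image)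
  then show ?thesis
    using measure_linear_image_det[of "(*v) A" "cball 0 1"] by (simp add: measure_translation)
qed

lemma unit_ball_eq_ellipsoid: "cball 0 1 = ellipsoid 0 (mat 1 :: real^'n^'n)"
  by (simp add: ellipsoid_def)

section \<open>Orthogonal and triangular matrices\<close>

lemma norm_transpose_orthogonal_mult:
  fixes Q :: "real^'n^'n"
  assumes "orthogonal_matrix Q"
  shows "norm (transpose Q *v u) = norm u"
proof -
  have "(transpose Q *v u) \<bullet> (transpose Q *v u) = u \<bullet> (Q *v (transpose Q *v u))"
    unfolding transpose_matrix_vector by (rule dot_lmul_matrix)
  also have "Q *v (transpose Q *v u) = u"
    using assms by (simp only: matrix_vector_mul_assoc orthogonal_matrix_def matrix_vector_mul_lid)
  finally show ?thesis
    by (simp add: norm_eq)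
qed

text \<open>Row norms survive the passage from \<open>A\<close> to its triangular form, which lets the information from
different triangular forms of the same matrix be combined.\<close>

lemma norm_row_mult_orthogonal:
  fixes A :: "real^'n^'m" and Q :: "real^'n^'n"
  assumes "orthogonal_matrix Q"
  shows "norm ((A ** Q) $ i) = norm (A $ i)"
proof -
  have "(A ** Q) $ i = transpose Q *v (A $ i)"
    by (simp add: vec_eq_iff matrix_matrix_mult_def vector_matrix_mult_def mult.commute)
  then show ?thesis
    by (simp only: norm_transpose_orthogonal_mult[OF assms])
qed

lemma ellipsoid_mult_orthogonal:
  fixes Q :: "real^'n^'n"
  assumes "orthogonal_matrix Q"
  shows "ellipsoid c (A ** Q) = ellipsoid c A"
proof -
  have Q': "norm (Q *v x) = norm x" for x
    using norm_transpose_orthogonal_mult[of "transpose Q" x] assms by simp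
  have QQ: "Q *v (transpose Q *v x) = x" for x
    using assms by (simp only: matrix_vector_mul_assoc orthogonal_matrix_def matrix_vector_mul_lid)
  have "(*v) Q ` cball 0 1 = cball 0 1"
  proof
    show "cball 0 1 \<subseteq> (*v) Q ` cball 0 1"
    proof
      fix x :: "real^'n"
      assume "x \<in> cball 0 1"
      then have "transpose Q *v x \<in> cball 0 1"
        by (simp only: mem_cball_0 norm_transpose_orthogonal_mult[OF assms])
      then show "x \<in> (*v) Q ` cball 0 1"
        using QQ[of x] by (metis imageI)
    qed
  qed (auto simp: Q')
  moreover have "ellipsoid c (A ** Q) = (\<lambda>x. c + A *v x) ` (*v) Q ` cball 0 1"
    by (simp add: ellipsoid_def image_image matrix_vector_mul_assoc)
  ultimately show ?thesis
    by (simp add: ellipsoid_def)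
qed

text \<open>A rank function \<open>f\<close> replaces an order on the index type, so that the same matrix can be treated with
different orders. A permutation \<open>p\<close> contributes to the determinant only if \<open>f (p i) \<le> f i\<close> for all \<open>i\<close>;
as both sides have the same sum, equality holds throughout and \<open>p\<close> is the identity.\<close>

lemma det_triangular_rank:
  fixes L :: "real^'n^'n" and f :: "'n \<Rightarrow> nat"
  assumes "inj f" and zero: "\<And>i j. f i < f j \<Longrightarrow> L $ i $ j = 0"
  shows "det L = (\<Prod>i\<in>UNIV. L $ i $ i)"
proof -
  have "of_int (sign p) * (\<Prod>i\<in>UNIV. L $ i $ p i) = 0" if p: "p permutes UNIV" "p \<noteq> id" for p
  proof (cases "\<exists>i. f i < f (p i)")
    case True
    then have "(\<Prod>i\<in>UNIV. L $ i $ p i) = 0"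
      by (intro prod_zero) (auto intro: zero)
    then show ?thesis by simp
  next
    case False
    have "(\<Sum>i\<in>UNIV. f (p i)) = (\<Sum>i\<in>UNIV. f i)"
      using sum.permute[OF p(1), of f] by (simp add: o_def)
    then have "f (p i) = f i" for i
      using False by (intro sum_mono_inv[of "\<lambda>i. f (p i)" UNIV f]) (auto simp: not_less)
    then have "p = id"
      using injD[OF \<open>inj f\<close>] by auto
    then show ?thesis
      using p(2) by simp
  qed
  then have "det L = (\<Sum>p\<in>{id}. of_int (sign p) * (\<Prod>i\<in>UNIV. L $ i $ p i))"
    unfolding det_def by (intro sum.mono_neutral_right) (auto simp: permutes_id)
  then show ?thesis
    by (simp add: sign_id)
qed

lemma row_notin_span_other_rows:
  fixes A :: "real^'n^'n"
  assumes "det A \<noteq> 0"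
  shows "A $ i \<notin> span {A $ j | j. j \<noteq> i}"
proof
  assume "A $ i \<in> span {A $ j | j. j \<noteq> i}"
  then have "- row i A \<in> vec.span {row j A | j. j \<noteq> i}"
    by (simp add: span_vec_eq span_neg row_def)
  from det_row_span[OF this] have "det A = det (\<chi> k. if k = i then 0 else row k A)"
    by (simp cong: if_cong)
  then show False
    using assms det_row_0[of i "\<lambda>k. row k A"] by simp
qed

text \<open>Gram-Schmidt without recursion: \<open>z i\<close> is the component of row \<open>i\<close> orthogonal to the span \<open>V i\<close> of the
rows of smaller rank. The normalized \<open>z i\<close> are the columns of \<open>Q\<close>, and the entries of \<open>A ** Q\<close> are
the inner products of the rows of \<open>A\<close> with them.\<close>

lemma exists_orthogonal_triangularization:
  fixes A :: "real^'n^'n" and f :: "'n \<Rightarrow> nat"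
  assumes "det A \<noteq> 0" "inj f"
  obtains Q where "orthogonal_matrix Q"
    "\<And>i j. f i < f j \<Longrightarrow> (A ** Q) $ i $ j = 0" "\<And>i. 0 < (A ** Q) $ i $ i"
proof -
  define V where "V i = {A $ j | j. f j < f i}" for i
  have "\<exists>y z. y \<in> span (V i) \<and> (\<forall>w\<in>span (V i). z \<bullet> w = 0) \<and> A $ i = y + z" for i
    using orthogonal_subspace_decomp_exists[of "V i" "A $ i"] by (metis orthogonal_def)
  then obtain y z where y: "\<And>i. y i \<in> span (V i)" and z: "\<And>i w. w \<in> span (V i) \<Longrightarrow> z i \<bullet> w = 0"
    and yz: "\<And>i. A $ i = y i + z i"
    by metis
  have z0: "z i \<noteq> 0" for i
  proof
    assume "z i = 0"
    then have "A $ i \<in> span (V i)"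
      using y[of i] yz[of i] by simp
    moreover have "V i \<subseteq> {A $ j | j. j \<noteq> i}"
      by (auto simp: V_def)
    ultimately show False
      using row_notin_span_other_rows[OF assms(1), of i] span_mono by blast
  qed
  have row_in: "A $ i \<in> span (V j)" if "f i < f j" for i j
    using that by (intro span_base) (auto simp: V_def)
  have z_in: "z i \<in> span (V j)" if "f i < f j" for i j
  proof -
    have "V i \<subseteq> V j"
      using that by (auto simp: V_def)
    then have "y i \<in> span (V j)"
      using y span_mono by blast
    then have "A $ i - y i \<in> span (V j)"
      using row_in[OF that] by (intro span_diff)
    then show ?thesis
      by (simp add: yz)
  qed
  \<comment> \<open>Whichever of \<open>i\<close>, \<open>j\<close> has the smaller rank, its \<open>z\<close> lies in the span to which the other is orthogonal.\<close>
  have z_orth: "z i \<bullet> z j = 0" if "i \<noteq> j" for i j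
    using that z[OF z_in[of i j]] z[OF z_in[of j i]] injD[OF assms(2), of i j]
    by (metis inner_commute linorder_neqE_nat)
  define Q :: "real^'n^'n" where "Q = (\<chi> k j. (z j /\<^sub>R norm (z j)) $ k)"
  have col: "column j Q = z j /\<^sub>R norm (z j)" for j
    by (simp add: Q_def column_def vec_eq_iff)
  have entry: "(A ** Q) $ i $ j = (A $ i \<bullet> z j) / norm (z j)" for i j
    by (simp add: Q_def matrix_matrix_mult_def inner_vec_def divide_inverse sum_distrib_right mult.assoc
        mult.commute[of "inverse (norm (z j))"])
  show ?thesis
  proof
    show "orthogonal_matrix Q"
      unfolding orthogonal_matrix_orthonormal_columns col
      using z0 z_orth by (simp add: orthogonal_def)
    show "(A ** Q) $ i $ j = 0" if "f i < f j" for i j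
      using z[OF row_in[OF that]] by (simp add: entry inner_commute)
    show "0 < (A ** Q) $ i $ i" for i
      using z[OF y[of i]] z0[of i] by (simp add: entry yz[of i] inner_add_left inner_commute[of "y i"])
  qed
qed

lemma exists_rank_first:
  fixes k :: "'n::finite"
  obtains f :: "'n \<Rightarrow> nat" where "inj f" "\<And>j. j \<noteq> k \<Longrightarrow> f k < f j"
proof -
  obtain h :: "'n \<Rightarrow> nat" where "inj h"
    using finite_imp_inj_to_nat_seg[of "UNIV :: 'n set"] by auto
  then have "inj (\<lambda>j. if j = k then 0 else Suc (h j))"
    by (auto simp: inj_on_def)
  then show ?thesis
    by (rule that) simp
qed

section \<open>Ellipsoids inside convex sets\<close>

text \<open>The left-hand side of the inequality is the support function of the ellipsoid; a point of the
ellipsoid outside \<open>K\<close> could be separated from \<open>K\<close> by a hyperplane.\<close>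

lemma ellipsoid_subset_convexI:
  assumes "closed K" "convex K"
    and "\<And>u. u \<noteq> 0 \<Longrightarrow> \<exists>y\<in>K. c \<bullet> u + norm (transpose M *v u) \<le> y \<bullet> u"
  shows "ellipsoid c M \<subseteq> K"
proof (rule ccontr)
  assume "\<not> ellipsoid c M \<subseteq> K"
  then obtain w where w: "norm w \<le> 1" "c + M *v w \<notin> K"
    unfolding ellipsoid_def by fastforce
  then obtain a b where a: "a \<bullet> (c + M *v w) < b" and K: "\<forall>x\<in>K. a \<bullet> x > b"
    using separating_hyperplane_closed_point[OF assms(2,1)] by blast
  define u where "u = - a"
  show False
  proof (cases "a = 0")
    case True
    then show False
      using a K assms(3)[of "axis undefined 1"] by (force simp: axis_eq_0_iff)
  next
    case False
    then obtain y where y: "y \<in> K" "c \<bullet> u + norm (transpose M *v u) \<le> y \<bullet> u"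
      using assms(3)[of u] by (auto simp: u_def)
    have "u \<bullet> (M *v w) = (transpose M *v u) \<bullet> w"
      by (simp add: dot_lmul_matrix)
    also have "\<dots> \<le> norm (transpose M *v u) * norm w"
      by (rule norm_cauchy_schwarz)
    also have "\<dots> \<le> norm (transpose M *v u)"
      using w(1) by (simp add: mult_left_le)
    finally have "u \<bullet> (c + M *v w) \<le> y \<bullet> u"
      using y(2) by (simp add: inner_add_right inner_commute)
    moreover have "y \<bullet> u < u \<bullet> (c + M *v w)"
      using a K y(1) by (force simp: u_def inner_commute)
    ultimately show False by simp
  qed
qed

text \<open>Spheroids with axis \<open>e\<close>: semiaxis \<open>a\<close> along \<open>e\<close> and \<open>b\<close> in the orthogonal directions. They are described
by volume and support function only, so \<open>M\<close> may be taken as rotation times diagonal matrix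
rather than as the symmetric matrix.\<close>

lemma exists_spheroid_matrix:
  fixes e :: "real^'n"
  assumes "norm e = 1" "0 \<le> a" "0 \<le> b"
  obtains M :: "real^'n^'n" where "\<bar>det M\<bar> = a * b ^ (CARD('n) - 1)"
    "\<And>u. (norm (transpose M *v u))\<^sup>2 = b\<^sup>2 * (norm u)\<^sup>2 + (a\<^sup>2 - b\<^sup>2) * (e \<bullet> u)\<^sup>2"
proof -
  obtain k :: 'n where True by simp
  obtain Q :: "real^'n^'n" where Q: "orthogonal_matrix Q" "Q *v axis k 1 = e"
    using orthogonal_matrix_exists_basis[OF assms(1)] by metis
  define d where "d i = (if i = k then a else b)" for i
  define D :: "real^'n^'n" where "D = (\<chi> i j. if i = j then d i else 0)"
  have "det D = prod d UNIV"
    unfolding D_def by (subst det_diagonal) auto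
  also have "\<dots> = a * b ^ (CARD('n) - 1)"
    by (simp add: prod.remove[of UNIV k] d_def card_Diff_singleton)
  finally have "\<bar>det (Q ** D)\<bar> = a * b ^ (CARD('n) - 1)"
    using det_orthogonal_matrix[OF Q(1)] assms by (auto simp: det_mul abs_mult)
  moreover have "(norm (transpose (Q ** D) *v u))\<^sup>2 =
      b\<^sup>2 * (norm u)\<^sup>2 + (a\<^sup>2 - b\<^sup>2) * (e \<bullet> u)\<^sup>2" for u
  proof -
    define v where "v = transpose Q *v u"
    have norm_v: "norm v = norm u"
      unfolding v_def by (rule norm_transpose_orthogonal_mult[OF Q(1)])
    have "v $ k = v \<bullet> axis k 1"
      by (simp add: inner_axis)
    also have "\<dots> = u \<bullet> (Q *v axis k 1)"
      unfolding v_def transpose_matrix_vector by (rule dot_lmul_matrix)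
    finally have vk: "v $ k = e \<bullet> u"
      by (simp add: Q(2) inner_commute)
    have "transpose (Q ** D) *v u = transpose D *v v"
      by (simp only: v_def matrix_transpose_mul matrix_vector_mul_assoc)
    also have "\<dots> = (\<chi> i. d i * v $ i)"
      by (simp add: D_def vec_eq_iff transpose_def matrix_vector_mult_def mult_delta_left)
    finally have "(norm (transpose (Q ** D) *v u))\<^sup>2 = (\<Sum>i\<in>UNIV. (d i)\<^sup>2 * (v $ i)\<^sup>2)"
      by (simp add: norm_vec_def L2_set_def sum_nonneg power_mult_distrib)
    also have "\<dots> = (\<Sum>i\<in>UNIV. b\<^sup>2 * (v $ i)\<^sup>2 + (if i = k then (a\<^sup>2 - b\<^sup>2) * (v $ i)\<^sup>2 else 0))"
      by (intro sum.cong) (auto simp: d_def algebra_simps)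
    also have "\<dots> = b\<^sup>2 * (norm v)\<^sup>2 + (a\<^sup>2 - b\<^sup>2) * (v $ k)\<^sup>2"
      by (simp add: sum.distrib sum_distrib_left[symmetric] norm_vec_def L2_set_def sum_nonneg)
    finally show ?thesis
      by (simp add: norm_v vk)
  qed
  ultimately show ?thesis
    using that by blast
qed

text \<open>The support functions to compare, in a direction of norm \<open>n\<close> whose component along the axis is \<open>t\<close>: on
the left the spheroid with center \<open>c e\<close> and squared semiaxes \<open>A\<close> along the axis and \<open>B\<close> across it, on
the right the convex hull of the unit ball with \<open>R e\<close> and \<open>-R' e\<close>. The values of \<open>c\<close> and \<open>A\<close> are
those for which the spheroid touches the two tangent cones from \<open>R e\<close> and \<open>-R' e\<close> to the ball, that
is, \<open>(R - c)\<^sup>2 = A + B (R\<^sup>2 - 1)\<close> and \<open>(R' + c)\<^sup>2 = A + B (R'\<^sup>2 - 1)\<close>. Equivalently,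
\<open>(n - c t)\<^sup>2 - (B n\<^sup>2 + (A - B) t\<^sup>2) = (1 - B) (n - R t) (n + R' t)\<close>.\<close>

lemma spheroid_support_le:
  fixes R R' B n t :: real
  assumes "1 \<le> R" "1 \<le> R'" "0 \<le> B" "B \<le> 1" "0 \<le> n"
  defines "c \<equiv> (R - R') * (1 - B) / 2"
  defines "A \<equiv> B + c\<^sup>2 + (1 - B) * (R * R')"
  shows "c * t + sqrt (B * n\<^sup>2 + (A - B) * t\<^sup>2) \<le> max n (max (R * t) (- R' * t))"
proof -
  have cR: "c \<le> R" "- R' \<le> c"
  proof -
    have "0 \<le> R * (1 + B) + R' * (1 - B)" "0 \<le> R' * (1 + B) + R * (1 - B)"
      using assms by (intro add_nonneg_nonneg mult_nonneg_nonneg; simp)+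
    then show "c \<le> R" "- R' \<le> c"
      by (simp_all add: c_def field_simps)
  qed
  have far: "B * n\<^sup>2 \<le> B * (r\<^sup>2 * t\<^sup>2)" if "n \<le> r * \<bar>t\<bar>" for r
    using power_mono[OF that \<open>0 \<le> n\<close>, of 2] \<open>0 \<le> B\<close>
    by (simp add: power_mult_distrib mult_left_mono)
  consider (right) "n \<le> R * t" | (left) "n \<le> - R' * t" | (mid) "R * t \<le> n" "- R' * t \<le> n"
    by linarith
  then show ?thesis
  proof cases
    case right
    then have "0 \<le> R * t" using \<open>0 \<le> n\<close> by linarith
    then have t: "0 \<le> t" using \<open>1 \<le> R\<close> by (simp add: zero_le_mult_iff)
    have "B * n\<^sup>2 + (A - B) * t\<^sup>2 \<le> B * (R\<^sup>2 * t\<^sup>2) + (A - B) * t\<^sup>2"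
      using far[of R] right t by simp
    also have "\<dots> = ((R - c) * t)\<^sup>2"
      unfolding A_def c_def by (simp add: field_simps power2_eq_square)
    finally have "sqrt (B * n\<^sup>2 + (A - B) * t\<^sup>2) \<le> (R - c) * t"
      using cR t by (intro real_le_lsqrt) auto
    then show ?thesis
      by (simp add: algebra_simps)
  next
    case left
    then have "0 \<le> R' * (- t)" using \<open>0 \<le> n\<close> by simp
    then have t: "t \<le> 0" using \<open>1 \<le> R'\<close> by (simp add: mult_le_0_iff)
    have "B * n\<^sup>2 + (A - B) * t\<^sup>2 \<le> B * (R'\<^sup>2 * t\<^sup>2) + (A - B) * t\<^sup>2"
      using far[of R'] left t by simp
    also have "\<dots> = ((R' + c) * (- t))\<^sup>2"
      unfolding A_def c_def by (simp add: field_simps power2_eq_square)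
    finally have "sqrt (B * n\<^sup>2 + (A - B) * t\<^sup>2) \<le> (R' + c) * (- t)"
      using cR t by (intro real_le_lsqrt) (auto simp: mult_nonneg_nonpos)
    then show ?thesis
      by (simp add: algebra_simps)
  next
    case mid
    have "c * t \<le> n"
    proof (cases "0 \<le> t")
      case True
      then show ?thesis using mult_right_mono[OF cR(1) True] mid by linarith
    next
      case False
      then have "c * t \<le> - R' * t" using cR(2) by (intro mult_right_mono_neg) auto
      then show ?thesis using mid by linarith
    qed
    have "0 \<le> (1 - B) * ((n - R * t) * (n + R' * t))"
      using mid assms by (intro mult_nonneg_nonneg) auto
    also have "\<dots> = (n - c * t)\<^sup>2 - (B * n\<^sup>2 + (A - B) * t\<^sup>2)"
      unfolding A_def c_def by (simp add: field_simps power2_eq_square)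
    finally have "sqrt (B * n\<^sup>2 + (A - B) * t\<^sup>2) \<le> n - c * t"
      using \<open>c * t \<le> n\<close> by (intro real_le_lsqrt) auto
    then show ?thesis
      by simp
  qed
qed

text \<open>With \<open>B = 1 - \<delta>\<close> the product is \<open>1 + \<delta> (P - d)\<close> up to second order in \<open>\<delta>\<close>, and Bernoulli's inequality
controls the error.\<close>

lemma exists_squared_semiaxis:
  fixes P :: real
  assumes "real d < P" "1 \<le> d"
  obtains B where "0 < B" "B < 1" "1 < (B + (1 - B) * P) * B ^ (d - 1)"
proof -
  \<comment> \<open>The second-order error is \<open>\<delta>\<^sup>2 (P - 1) (d - 1)\<close>, so \<open>\<delta>\<close> has to satisfy \<open>\<delta> (P - 1) (d - 1) < P - d\<close>.\<close>
  define \<delta> where "\<delta> = (P - d) / (P * d)"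
  have "0 < \<delta>" "\<delta> < 1"
  proof -
    have "P * 1 \<le> P * d"
      using assms by (intro mult_left_mono) auto
    moreover have "0 < real d"
      using assms by simp
    ultimately have "P - d < P * d" "0 < P * d"
      using assms by linarith+
    then show "0 < \<delta>" "\<delta> < 1"
      using assms by (simp_all add: \<delta>_def divide_less_eq_1)
  qed
  have "(P - 1) * (real d - 1) < P * d"
    using assms by (simp add: algebra_simps)
  then have "\<delta> * ((P - 1) * (real d - 1)) < \<delta> * (P * d)"
    using \<open>0 < \<delta>\<close> by (rule mult_strict_left_mono)
  also have "\<delta> * (P * d) = P - d"
    using assms by (simp add: \<delta>_def)
  finally have "0 < \<delta> * ((P - d) - \<delta> * ((P - 1) * (real d - 1)))"
    using \<open>0 < \<delta>\<close> by simp
  then have "1 < (1 + \<delta> * (P - 1)) * (1 - (real d - 1) * \<delta>)"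
    by (simp add: algebra_simps)
  also have "\<dots> \<le> (1 + \<delta> * (P - 1)) * (1 - \<delta>) ^ (d - 1)"
    using Bernoulli_inequality[of "- \<delta>" "d - 1"] \<open>0 < \<delta>\<close> \<open>\<delta> < 1\<close> assms
    by (intro mult_left_mono) (auto simp: of_nat_diff)
  finally show ?thesis
    using \<open>0 < \<delta>\<close> \<open>\<delta> < 1\<close> by (intro that[of "1 - \<delta>"]) (auto simp: algebra_simps)
qed

text \<open>The heart of the upper bound: among the spheroids of \<open>spheroid_support_le\<close> there is one of larger
volume than the ball as soon as the product of the distances of the two points from the origin exceeds
the dimension.\<close>

lemma exists_large_ellipsoid_two_points:
  fixes K :: "(real^'n) set"
  assumes K: "closed K" "convex K" "cball 0 1 \<subseteq> K"
    and e: "norm e = 1" "R *\<^sub>R e \<in> K" "- R' *\<^sub>R e \<in> K"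
    and R: "1 \<le> R" "1 \<le> R'" "real CARD('n) < R * R'"
  obtains c M where "ellipsoid c M \<subseteq> K" "1 < \<bar>det M\<bar>"
proof -
  obtain B where B: "0 < B" "B < 1" "1 < (B + (1 - B) * (R * R')) * B ^ (CARD('n) - 1)"
    using exists_squared_semiaxis[OF R(3)] by (auto simp: Suc_le_eq)
  define c where "c = (R - R') * (1 - B) / 2"
  define A where "A = B + c\<^sup>2 + (1 - B) * (R * R')"
  have "0 < A"
    unfolding A_def using B R by (intro add_pos_nonneg) auto
  obtain M :: "real^'n^'n" where M: "\<bar>det M\<bar> = sqrt A * sqrt B ^ (CARD('n) - 1)"
    "\<And>u. (norm (transpose M *v u))\<^sup>2 = (sqrt B)\<^sup>2 * (norm u)\<^sup>2 + ((sqrt A)\<^sup>2 - (sqrt B)\<^sup>2) * (e \<bullet> u)\<^sup>2"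
    by (rule exists_spheroid_matrix[OF e(1), of "sqrt A" "sqrt B"]) (use \<open>0 < A\<close> \<open>0 < B\<close> in auto)
  have "ellipsoid (c *\<^sub>R e) M \<subseteq> K"
  proof (rule ellipsoid_subset_convexI[OF K(1,2)])
    fix u :: "real^'n"
    assume "u \<noteq> 0"
    have "norm (transpose M *v u) = sqrt (B * (norm u)\<^sup>2 + (A - B) * (e \<bullet> u)\<^sup>2)"
      using M(2)[of u] \<open>0 < A\<close> \<open>0 < B\<close> by (intro real_sqrt_unique[symmetric]) simp_all
    then have "(c *\<^sub>R e) \<bullet> u + norm (transpose M *v u) \<le>
        max (norm u) (max (R * (e \<bullet> u)) (- R' * (e \<bullet> u)))"
      using spheroid_support_le[of R R' B "norm u" "e \<bullet> u", folded c_def, folded A_def] R(1,2) B(1,2)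
      by (simp only: inner_scaleR_left) simp
    moreover have "(u /\<^sub>R norm u) \<bullet> u = norm u"
      using \<open>u \<noteq> 0\<close> by (simp add: dot_square_norm power2_eq_square)
    ultimately consider "(c *\<^sub>R e) \<bullet> u + norm (transpose M *v u) \<le> (u /\<^sub>R norm u) \<bullet> u"
      | "(c *\<^sub>R e) \<bullet> u + norm (transpose M *v u) \<le> (R *\<^sub>R e) \<bullet> u"
      | "(c *\<^sub>R e) \<bullet> u + norm (transpose M *v u) \<le> (- R' *\<^sub>R e) \<bullet> u"
      unfolding le_max_iff_disj inner_scaleR_left by linarith
    then show "\<exists>y\<in>K. (c *\<^sub>R e) \<bullet> u + norm (transpose M *v u) \<le> y \<bullet> u"
    proof cases
      case 1
      moreover have "u /\<^sub>R norm u \<in> K"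
        using \<open>u \<noteq> 0\<close> by (intro subsetD[OF K(3)]) simp
      ultimately show ?thesis by blast
    qed (use e in blast)+
  qed
  moreover have "1 < \<bar>det M\<bar>"
  proof -
    have "1 < A * B ^ (CARD('n) - 1)"
      using B(1) by (intro less_le_trans[OF B(3)] mult_right_mono) (simp_all add: A_def)
    then have "1 < sqrt (A * B ^ (CARD('n) - 1))"
      by simp
    then show ?thesis
      by (simp add: M(1) real_sqrt_mult real_sqrt_power)
  qed
  ultimately show ?thesis
    by (rule that)
qed

text \<open>The spheroid centered halfway between the balls, with semiaxis \<open>1 + norm c / 2\<close> along \<open>c\<close> and \<open>1\<close> across,
fits into their convex hull.\<close>

lemma exists_large_ellipsoid_capsule:
  fixes K :: "(real^'n) set"
  assumes K: "closed K" "convex K" "cball 0 1 \<subseteq> K" "cball c 1 \<subseteq> K" and "c \<noteq> 0"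
  obtains c' M where "ellipsoid c' M \<subseteq> K" "1 < \<bar>det M\<bar>"
proof -
  define e where "e = c /\<^sub>R norm c"
  have "norm e = 1"
    using \<open>c \<noteq> 0\<close> by (simp add: e_def)
  define l where "l = norm c"
  have "0 < l"
    using \<open>c \<noteq> 0\<close> by (simp add: l_def)
  obtain M :: "real^'n^'n" where M: "\<bar>det M\<bar> = 1 + l / 2"
    "\<And>u. (norm (transpose M *v u))\<^sup>2 = (norm u)\<^sup>2 + ((1 + l / 2)\<^sup>2 - 1) * (e \<bullet> u)\<^sup>2"
    by (rule exists_spheroid_matrix[OF \<open>norm e = 1\<close>, of "1 + l / 2" 1]) (use \<open>0 < l\<close> in auto)
  have "ellipsoid (c /\<^sub>R 2) M \<subseteq> K"
  proof (rule ellipsoid_subset_convexI[OF K(1,2)])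
    fix u :: "real^'n"
    assume "u \<noteq> 0"
    have "\<bar>e \<bullet> u\<bar> \<le> norm u"
      using Cauchy_Schwarz_ineq2[of e u] \<open>norm e = 1\<close> by simp
    then have "\<bar>e \<bullet> u\<bar> * \<bar>e \<bullet> u\<bar> \<le> norm u * \<bar>e \<bullet> u\<bar>"
      by (intro mult_right_mono) auto
    then have "l * (e \<bullet> u)\<^sup>2 \<le> l * (norm u * \<bar>e \<bullet> u\<bar>)"
      using \<open>0 < l\<close> by (simp add: power2_eq_square)
    then have "(norm (transpose M *v u))\<^sup>2 \<le> (norm u + l / 2 * \<bar>e \<bullet> u\<bar>)\<^sup>2"
      unfolding M(2) by (simp add: power2_sum power_mult_distrib) (simp add: power2_eq_square algebra_simps)
    then have "norm (transpose M *v u) \<le> norm u + l / 2 * \<bar>e \<bullet> u\<bar>"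
      by (rule power2_le_imp_le) (use \<open>0 < l\<close> in simp)
    moreover have "c \<bullet> u = l * (e \<bullet> u)"
      using \<open>c \<noteq> 0\<close> by (simp add: e_def l_def)
    ultimately have "(c /\<^sub>R 2) \<bullet> u + norm (transpose M *v u) \<le> norm u + max 0 (c \<bullet> u)"
      by (cases "0 \<le> e \<bullet> u") (simp_all add: max_def field_simps)
    moreover have "(u /\<^sub>R norm u) \<bullet> u = norm u"
      using \<open>u \<noteq> 0\<close> by (simp add: dot_square_norm power2_eq_square)
    moreover have "u /\<^sub>R norm u \<in> K" "c + u /\<^sub>R norm u \<in> K"
      using \<open>u \<noteq> 0\<close> by (intro subsetD[OF K(3)] subsetD[OF K(4)]; simp add: dist_norm)+
    ultimately show "\<exists>y\<in>K. (c /\<^sub>R 2) \<bullet> u + norm (transpose M *v u) \<le> y \<bullet> u"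
      by (smt (verit) inner_add_left)
  qed
  then show ?thesis
    using that M(1) \<open>0 < l\<close> by auto
qed

lemma midpoint_ellipsoid_subset:
  fixes A B :: "real^'n^'n"
  assumes "convex K" "ellipsoid a A \<subseteq> K" "ellipsoid b B \<subseteq> K"
  shows "ellipsoid ((1/2) *\<^sub>R (a + b)) ((1/2) *\<^sub>R (A + B)) \<subseteq> K"
proof
  fix x
  assume "x \<in> ellipsoid ((1/2) *\<^sub>R (a + b)) ((1/2) *\<^sub>R (A + B))"
  then obtain w where "w \<in> cball 0 1" and x: "x = (1/2) *\<^sub>R (a + b) + ((1/2) *\<^sub>R (A + B)) *v w"
    unfolding ellipsoid_def by auto
  then have "a + A *v w \<in> K" "b + B *v w \<in> K"
    using assms(2,3) unfolding ellipsoid_def by blast+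
  then have "(1/2) *\<^sub>R (a + A *v w) + (1/2) *\<^sub>R (b + B *v w) \<in> K"
    using \<open>convex K\<close> by (intro convexD) auto
  then show "x \<in> K"
    by (simp add: x scaleR_matrix_vector_assoc[symmetric] matrix_vector_mult_add_rdistrib algebra_simps)
qed

section \<open>Uniqueness of the John center\<close>

text \<open>The strict arithmetic-geometric mean inequality \<open>l \<le> ((1 + l) / 2)\<^sup>2\<close>, factor by factor.\<close>

lemma prod_gt_one_midpoints:
  fixes l :: "'n::finite \<Rightarrow> real"
  assumes "\<And>i. 0 < l i" "(\<Prod>i\<in>UNIV. l i) = 1" "l k \<noteq> 1"
  shows "1 < (\<Prod>i\<in>UNIV. (1 + l i) / 2)"
proof -
  have amgm: "l i \<le> ((1 + l i) / 2)\<^sup>2" for i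
    using zero_le_power2[of "l i - 1"] by (simp add: power2_eq_square field_simps)
  have "0 < (l k - 1)\<^sup>2"
    using assms(3) by simp
  then have "l k < ((1 + l k) / 2)\<^sup>2"
    by (simp add: power2_eq_square field_simps)
  then have "(\<Prod>i\<in>UNIV. l i) < (\<Prod>i\<in>UNIV. ((1 + l i) / 2)\<^sup>2)"
    using amgm less_imp_le[OF assms(1)] less_le_trans[OF assms(1) amgm]
    by (intro prod_mono_strict[of k]) simp_all
  then have "1\<^sup>2 < (\<Prod>i\<in>UNIV. (1 + l i) / 2)\<^sup>2"
    by (simp only: assms(2) prod_power_distrib one_power2)
  then show ?thesis
    by (rule power_less_imp_less_base) (simp add: prod_nonneg less_imp_le[OF assms(1)])
qed

text \<open>Otherwise the average of the ellipsoid with the unit ball is too large: averaging with the identity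
keeps the triangular form, so both determinants are products of diagonal entries.\<close>

lemma triangular_diagonal_eq_one:
  fixes L :: "real^'n^'n"
  assumes K: "convex K" "cball 0 1 \<subseteq> K" "ellipsoid c L \<subseteq> K"
    and max: "\<And>b M. ellipsoid b M \<subseteq> K \<Longrightarrow> \<bar>det M\<bar> \<le> 1"
    and L: "inj f" "\<And>i j. f i < (f j :: nat) \<Longrightarrow> L $ i $ j = 0" "\<And>i. 0 < L $ i $ i" "\<bar>det L\<bar> = 1"
  shows "L $ k $ k = 1"
proof (rule ccontr)
  assume k: "L $ k $ k \<noteq> 1"
  have detL: "det L = (\<Prod>i\<in>UNIV. L $ i $ i)"
    by (rule det_triangular_rank[OF L(1,2)])
  have "0 < (\<Prod>i\<in>UNIV. L $ i $ i)"
    by (intro prod_pos) (use L(3) in auto)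
  then have "(\<Prod>i\<in>UNIV. L $ i $ i) = 1"
    using L(4) detL by simp
  then have big: "1 < (\<Prod>i\<in>UNIV. (1 + L $ i $ i) / 2)"
    using L(3) k by (intro prod_gt_one_midpoints)
  let ?M = "(1/2) *\<^sub>R (mat 1 + L)"
  have "ellipsoid ((1/2) *\<^sub>R (0 + c)) ?M \<subseteq> K"
    using K unfolding unit_ball_eq_ellipsoid by (rule midpoint_ellipsoid_subset)
  then have "\<bar>det ?M\<bar> \<le> 1"
    by (rule max)
  moreover have "?M $ i $ j = 0" if "f i < f j" for i j
    using that L(2)[OF that] by (auto simp: mat_def)
  then have "det ?M = (\<Prod>i\<in>UNIV. ?M $ i $ i)"
    by (rule det_triangular_rank[OF L(1)])
  ultimately show False
    using big by (simp add: mat_def)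
qed

text \<open>The diagonal is \<open>1\<close> in every triangular form of \<open>A\<close>. In a form in which \<open>k\<close> comes first, row \<open>k\<close> consists of
its diagonal entry alone, so row \<open>k\<close> of \<open>A\<close> has norm \<open>1\<close>. In any one triangular form, all rows are then
unit vectors with diagonal entry \<open>1\<close>, which leaves only the identity matrix.\<close>

lemma ellipsoid_eq_cball_of_max:
  fixes A :: "real^'n^'n"
  assumes K: "convex K" "cball 0 1 \<subseteq> K" "ellipsoid c A \<subseteq> K"
    and max: "\<And>b M. ellipsoid b M \<subseteq> K \<Longrightarrow> \<bar>det M\<bar> \<le> 1"
    and A: "\<bar>det A\<bar> = 1"
  shows "ellipsoid c A = cball c 1"
proof -
  have "det A \<noteq> 0"
    using A by auto
  have diag: "(A ** Q) $ i $ i = 1" if "orthogonal_matrix Q" "inj f"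
      "\<And>i j. f i < (f j :: nat) \<Longrightarrow> (A ** Q) $ i $ j = 0" "\<And>i. 0 < (A ** Q) $ i $ i" for Q f i
  proof (rule triangular_diagonal_eq_one[OF K(1,2) _ max that(2-4)])
    show "ellipsoid c (A ** Q) \<subseteq> K"
      using K(3) by (simp add: ellipsoid_mult_orthogonal[OF that(1)])
    show "\<bar>det (A ** Q)\<bar> = 1"
      using A det_orthogonal_matrix[OF that(1)] by (auto simp: det_mul abs_mult)
  qed
  have norm_row: "norm (A $ k) = 1" for k
  proof -
    obtain f :: "'n \<Rightarrow> nat" where f: "inj f" "\<And>j. j \<noteq> k \<Longrightarrow> f k < f j"
      using exists_rank_first[of k] by metis
    obtain Q where Q: "orthogonal_matrix Q"
      "\<And>i j. f i < f j \<Longrightarrow> (A ** Q) $ i $ j = 0" "\<And>i. 0 < (A ** Q) $ i $ i"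
      using exists_orthogonal_triangularization[OF \<open>det A \<noteq> 0\<close> f(1)] by metis
    have "(A ** Q) $ k = axis k 1"
      using Q(2)[OF f(2)] diag[OF Q(1) f(1) Q(2,3)] by (simp add: vec_eq_iff axis_def)
    then show ?thesis
      using norm_row_mult_orthogonal[OF Q(1), of A k] by simp
  qed
  obtain f :: "'n \<Rightarrow> nat" where f: "inj f"
    using exists_rank_first by metis
  obtain Q where Q: "orthogonal_matrix Q"
    "\<And>i j. f i < f j \<Longrightarrow> (A ** Q) $ i $ j = 0" "\<And>i. 0 < (A ** Q) $ i $ i"
    using exists_orthogonal_triangularization[OF \<open>det A \<noteq> 0\<close> f(1)] by metis
  have "(A ** Q) $ i = axis i 1" for i
  proof -
    have "(norm ((A ** Q) $ i - axis i 1))\<^sup>2 =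
        (norm ((A ** Q) $ i))\<^sup>2 - 2 * ((A ** Q) $ i \<bullet> axis i 1) + (norm (axis i 1 :: real^'n))\<^sup>2"
      unfolding power2_norm_eq_inner by (simp add: inner_diff_left inner_diff_right inner_commute)
    also have "\<dots> = 0"
      using diag[OF Q(1) f Q(2,3), of i]
      by (simp add: norm_row_mult_orthogonal[OF Q(1)] norm_row inner_axis)
    finally show ?thesis by simp
  qed
  then have "A ** Q = mat 1"
    by (simp add: vec_eq_iff mat_def axis_def)
  then have "ellipsoid c A = ellipsoid c (mat 1)"
    by (metis ellipsoid_mult_orthogonal[OF Q(1)])
  also have "\<dots> = (+) c ` cball 0 1"
    by (simp add: ellipsoid_def)
  also have "\<dots> = cball c 1"
    by (simp add: cball_translation[symmetric])
  finally show ?thesis .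
qed

lemma abs_det_le_one_of_max:
  fixes K :: "(real^'n) set"
  assumes "max_volume_ellipsoid K (cball 0 1)" "ellipsoid b M \<subseteq> K"
  shows "\<bar>det M\<bar> \<le> 1"
proof (cases "det M = 0")
  case False
  then have "is_ellipsoid (ellipsoid b M)"
    by (auto simp: is_ellipsoid_def invertible_det_nz)
  then have "measure lebesgue (ellipsoid b M) \<le> measure lebesgue (cball (0::real^'n) 1)"
    using assms by (simp add: max_volume_ellipsoid_def)
  moreover have "0 < measure lebesgue (cball (0::real^'n) 1)"
    using content_cball_pos[of 1 "0::real^'n"] by simp
  ultimately show ?thesis
    by (simp add: measure_ellipsoid)
qed simp

text \<open>By \<open>ellipsoid_eq_cball_of_max\<close> another maximal ellipsoid is a translate of the unit ball, and by
\<open>exists_large_ellipsoid_capsule\<close> it is not a proper one.\<close>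

lemma john_center_eq_zero:
  fixes K :: "(real^'n) set"
  assumes K: "closed K" "convex K" and max: "max_volume_ellipsoid K (cball 0 1)"
  shows "john_center K = 0"
  unfolding john_center_def
proof (rule the_equality)
  show "\<exists>A. invertible A \<and> max_volume_ellipsoid K (ellipsoid 0 A)"
    using max unfolding unit_ball_eq_ellipsoid by (intro exI[of _ "mat 1"]) (simp add: invertible_det_nz)
next
  fix c :: "real^'n"
  assume "\<exists>A. invertible A \<and> max_volume_ellipsoid K (ellipsoid c A)"
  then obtain A :: "real^'n^'n" where A: "max_volume_ellipsoid K (ellipsoid c A)"
    by blast
  have sub: "cball 0 1 \<subseteq> K" "ellipsoid c A \<subseteq> K"
    using A max by (simp_all add: max_volume_ellipsoid_def)
  have "measure lebesgue (cball (0::real^'n) 1) \<le> measure lebesgue (ellipsoid c A)"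
    using A max unfolding max_volume_ellipsoid_def by blast
  moreover have "0 < measure lebesgue (cball (0::real^'n) 1)"
    using content_cball_pos[of 1 "0::real^'n"] by simp
  ultimately have "1 \<le> \<bar>det A\<bar>"
    by (simp add: measure_ellipsoid)
  then have "\<bar>det A\<bar> = 1"
    using abs_det_le_one_of_max[OF max sub(2)] by simp
  with abs_det_le_one_of_max[OF max] have "ellipsoid c A = cball c 1"
    by (intro ellipsoid_eq_cball_of_max[OF K(2) sub])
  then have "cball c 1 \<subseteq> K"
    using sub(2) by simp
  show "c = 0"
  proof (rule ccontr)
    assume "c \<noteq> 0"
    then obtain b and M :: "real^'n^'n" where "ellipsoid b M \<subseteq> K" "1 < \<bar>det M\<bar>"
      by (rule exists_large_ellipsoid_capsule[OF K sub(1) \<open>cball c 1 \<subseteq> K\<close>])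
    then show False
      using abs_det_le_one_of_max[OF max] by fastforce
  qed
qed

section \<open>Circumradius and asymmetry\<close>

lemma scaleR_image_mem_iff:
  fixes S :: "'a::real_vector set"
  assumes "0 < r"
  shows "x \<in> (\<lambda>y. r *\<^sub>R y) ` S \<longleftrightarrow> x /\<^sub>R r \<in> S"
proof
  assume "x /\<^sub>R r \<in> S"
  then have "r *\<^sub>R (x /\<^sub>R r) \<in> (\<lambda>y. r *\<^sub>R y) ` S"
    by blast
  then show "x \<in> (\<lambda>y. r *\<^sub>R y) ` S"
    using assms by simp
qed (use assms in auto)

lemma subset_scaled_ball_iff:
  fixes S :: "'a::real_normed_vector set"
  assumes "0 \<le> r"
  shows "S \<subseteq> (\<lambda>x. r *\<^sub>R x) ` cball 0 1 \<longleftrightarrow> (\<forall>x\<in>S. norm x \<le> r)"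
proof (cases "r = 0")
  case False
  then show ?thesis
    using assms by (auto simp: scaleR_image_mem_iff subset_iff field_simps)
next
  case True
  then have "(\<lambda>x. r *\<^sub>R x) ` cball (0::'a) 1 = {0}"
    by (auto simp: image_iff intro!: exI[of _ 0])
  then show ?thesis
    using True by auto
qed

lemma circumradius_attained:
  fixes K :: "'a::real_normed_vector set"
  assumes "compact K" "K \<noteq> {}"
  defines "\<rho> \<equiv> (LEAST r. 0 \<le> r \<and> K \<subseteq> (\<lambda>x. r *\<^sub>R x) ` cball 0 1)"
  shows "\<exists>x\<in>K. norm x = \<rho> \<and> (\<forall>y\<in>K. norm y \<le> \<rho>)"
proof -
  obtain x where x: "x \<in> K" "\<And>y. y \<in> K \<Longrightarrow> norm y \<le> norm x"
    using continuous_attains_sup[OF assms(1,2), of norm] continuous_on_norm_id by blast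
  have "\<rho> = norm x"
    unfolding \<rho>_def by (rule Least_equality) (use x in \<open>auto simp: subset_scaled_ball_iff\<close>)
  then show ?thesis
    using x by auto
qed

text \<open>Turns the \<open>LEAST\<close> in the John asymmetry (for center \<open>0\<close>) into a positive number with the required
containment, by proving that the infimum of the admissible ratios is admissible. It is positive
because \<open>K\<close> is bounded and contains a nonzero point; since \<open>K\<close> is star-shaped about \<open>0\<close>, all ratios above
the infimum are admissible, and closedness of \<open>K\<close> adds the infimum itself.\<close>

lemma reflection_ratio_attained:
  fixes K :: "'a::real_normed_vector set"
  assumes K: "compact K" "convex K" "cball 0 1 \<subseteq> K" and nontrivial: "\<exists>x\<in>K. x \<noteq> 0"
  defines "s \<equiv> (LEAST r. 0 \<le> r \<and> uminus ` K \<subseteq> (\<lambda>x. r *\<^sub>R x) ` K)"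
  shows "0 < s \<and> (\<forall>x\<in>K. - x /\<^sub>R s \<in> K)"
proof -
  define S where "S = {r. 0 \<le> r \<and> uminus ` K \<subseteq> (\<lambda>x. r *\<^sub>R x) ` K}"
  obtain b where b: "\<And>x. x \<in> K \<Longrightarrow> norm x \<le> b"
    using compact_imp_bounded[OF K(1)] by (auto simp: bounded_iff)
  obtain x0 where x0: "x0 \<in> K" "x0 \<noteq> 0"
    using nontrivial by blast
  then have "0 < b"
    using less_le_trans[OF _ b[of x0]] by simp
  have S_lower: "norm x0 / b \<le> r" if "r \<in> S" for r
  proof -
    have "- x0 \<in> (\<lambda>x. r *\<^sub>R x) ` K"
      using that x0(1) by (auto simp: S_def)
    then obtain k where "k \<in> K" "- x0 = r *\<^sub>R k"
      by auto
    then have "norm x0 = \<bar>r\<bar> * norm k"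
      by (metis norm_minus_cancel norm_scaleR)
    also have "\<dots> \<le> r * b"
      using that b[OF \<open>k \<in> K\<close>] by (simp add: S_def mult_left_mono)
    finally have "norm x0 \<le> r * b" .
    then show ?thesis
      using \<open>0 < b\<close> by (simp add: divide_le_eq)
  qed
  have pos: "0 < norm x0 / b"
    using x0(2) \<open>0 < b\<close> by simp
  have S_iff: "r \<in> S \<longleftrightarrow> (\<forall>x\<in>K. - x /\<^sub>R r \<in> K)" if "0 < r" for r
    using that by (auto simp: S_def image_subset_iff scaleR_image_mem_iff)
  have "b \<in> S"
    unfolding S_iff[OF \<open>0 < b\<close>]
    using b \<open>0 < b\<close> by (intro ballI subsetD[OF K(3)]) (simp add: field_simps)
  have bdd: "bdd_below S"
    using S_lower by (rule bdd_belowI)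
  define t where "t = Inf S"
  have "0 < t"
    unfolding t_def by (rule less_le_trans[OF pos cInf_greatest]) (use \<open>b \<in> S\<close> S_lower in auto)
  have above: "- x /\<^sub>R r \<in> K" if "x \<in> K" "t < r" for x r
  proof -
    obtain q where q: "q \<in> S" "q < r"
      using \<open>t < r\<close> \<open>b \<in> S\<close> cInf_less_iff[OF _ bdd] unfolding t_def by blast
    have "0 < q"
      using S_lower[OF q(1)] pos by linarith
    have "- x /\<^sub>R q \<in> K"
      using q(1) S_iff[OF \<open>0 < q\<close>] that(1) by blast
    moreover have "0 \<in> K"
      using K(3) by auto
    \<comment> \<open>\<open>-x/r\<close> is a convex combination of \<open>0\<close> and \<open>-x/q\<close>.\<close>
    ultimately have "(1 - q / r) *\<^sub>R 0 + (q / r) *\<^sub>R (- x /\<^sub>R q) \<in> K"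
      using \<open>0 < q\<close> q(2) by (intro convexD[OF K(2)]) (auto simp: field_simps)
    moreover have "q / r * inverse q = inverse r"
      using \<open>0 < q\<close> by (simp add: field_simps)
    ultimately show ?thesis
      by simp
  qed
  have "- x /\<^sub>R t \<in> K" if "x \<in> K" for x
  proof (rule Lim_in_closed_set[OF compact_imp_closed[OF K(1)]])
    show "\<forall>\<^sub>F r in at_right t. - x /\<^sub>R r \<in> K"
      using above[OF that] by (auto simp: eventually_at_filter)
    show "((\<lambda>r. - x /\<^sub>R r) \<longlongrightarrow> - x /\<^sub>R t) (at_right t)"
      using \<open>0 < t\<close> by (intro tendsto_intros) auto
  qed simp
  moreover from this have "t \<in> S"
    using S_iff[OF \<open>0 < t\<close>] by blast
  then have "s = t"
    unfolding s_def using cInf_lower[OF _ bdd]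
    by (intro Least_equality) (auto simp: S_def t_def)
  ultimately show ?thesis
    using \<open>0 < t\<close> by simp
qed

lemma minkowski_asymmetry_le_radius:
  fixes K :: "(real^'n) set"
  assumes "cball 0 1 \<subseteq> K" "0 < r" "\<And>x. x \<in> K \<Longrightarrow> norm x \<le> r"
  shows "minkowski_asymmetry K \<le> r"
  unfolding minkowski_asymmetry_def
proof (rule cInf_lower)
  have "- x /\<^sub>R r \<in> K" if "x \<in> K" for x
    using assms(2) assms(3)[OF that] by (intro subsetD[OF assms(1)]) (simp add: field_simps)
  then have "uminus ` K \<subseteq> (\<lambda>x. r *\<^sub>R x) ` K"
    using assms(2) by (auto simp: image_subset_iff scaleR_image_mem_iff)
  then show "r \<in> {\<rho>. 0 \<le> \<rho> \<and> (\<exists>c. uminus ` K \<subseteq> (\<lambda>x. c + \<rho> *\<^sub>R x) ` K)}"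
    using assms(2) by (auto intro!: exI[of _ 0])
  show "bdd_below {\<rho>. 0 \<le> \<rho> \<and> (\<exists>c. uminus ` K \<subseteq> (\<lambda>x. c + \<rho> *\<^sub>R x) ` K)}"
    by (rule bdd_belowI[of _ 0]) simp
qed

text \<open>The two axis points are \<open>x\<close> and \<open>-x/s\<close>. If \<open>-x/s\<close> lies inside the ball, it is replaced by the antipode
of the direction of \<open>x\<close> on the unit sphere, which only increases the product of the distances from the origin.\<close>

lemma norm_power2_le_of_max:
  fixes K :: "(real^'n) set"
  assumes K: "closed K" "convex K" and max: "max_volume_ellipsoid K (cball 0 1)"
    and x: "x \<in> K" "1 \<le> norm x" and s: "0 < s" "- x /\<^sub>R s \<in> K"
  shows "(norm x)\<^sup>2 \<le> s * real CARD('n)"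
proof (rule ccontr)
  assume "\<not> (norm x)\<^sup>2 \<le> s * real CARD('n)"
  then have big: "real CARD('n) < norm x * (norm x / s)"
    using s(1) by (simp add: field_simps power2_eq_square)
  have sub: "cball 0 1 \<subseteq> K"
    using max by (simp add: max_volume_ellipsoid_def)
  define e where "e = x /\<^sub>R norm x"
  define R' where "R' = max 1 (norm x / s)"
  have "norm x \<noteq> 0"
    using x(2) by linarith
  then have e: "norm e = 1" "norm x *\<^sub>R e \<in> K"
    using x by (simp_all add: e_def)
  have "- R' *\<^sub>R e \<in> K"
  proof (cases "1 \<le> norm x / s")
    case True
    moreover have "norm x / s * inverse (norm x) = inverse s"
      using \<open>norm x \<noteq> 0\<close> by (simp add: field_simps)
    ultimately show ?thesis
      using s(2) by (simp add: R'_def e_def)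
  next
    case False
    then show ?thesis
      using e(1) by (intro subsetD[OF sub]) (simp add: R'_def)
  qed
  moreover have "norm x * (norm x / s) \<le> norm x * R'"
    unfolding R'_def by (intro mult_left_mono) auto
  ultimately obtain b and M :: "real^'n^'n" where "ellipsoid b M \<subseteq> K" "1 < \<bar>det M\<bar>"
    using exists_large_ellipsoid_two_points[OF K sub e _ x(2), of R'] big
    by (auto simp: R'_def)
  then show False
    using abs_det_le_one_of_max[OF max] by fastforce
qed

theorem theorem7p1:
  fixes K :: "(real ^ 'n) set"
  assumes "convex_body K"
    and "full_dimensional K"
    and "max_volume_ellipsoid K (cball 0 1)"
  defines "\<rho> \<equiv> (LEAST r. 0 \<le> r \<and> K \<subseteq> (\<lambda>x. r *\<^sub>R x) ` cball 0 1)"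
  shows "minkowski_asymmetry K \<le> \<rho> \<and> \<rho> \<le> sqrt (john_asymmetry K * real CARD('n))"
proof -
  have K: "compact K" "convex K" "K \<noteq> {}" and sub: "cball 0 1 \<subseteq> K"
    using assms(1,3) by (simp_all add: convex_body_def max_volume_ellipsoid_def)
  obtain x where x: "x \<in> K" "norm x = \<rho>" "\<And>y. y \<in> K \<Longrightarrow> norm y \<le> \<rho>"
    using circumradius_attained[OF K(1,3), folded \<rho>_def] by blast
  \<comment> \<open>Any unit vector shows that the circumradius is at least \<open>1\<close> and that \<open>K\<close> has a nonzero point.\<close>
  obtain e :: "real^'n" where "norm e = 1"
    using vector_choose_size[of 1] by auto
  then have "e \<in> K" "e \<noteq> 0"
    using sub by auto
  have "1 \<le> \<rho>"
    using x(3)[OF \<open>e \<in> K\<close>] \<open>norm e = 1\<close> by simp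
  define s where "s = john_asymmetry K"
  have "john_center K = 0"
    by (rule john_center_eq_zero[OF compact_imp_closed[OF K(1)] K(2) assms(3)])
  then have "s = (LEAST r. 0 \<le> r \<and> uminus ` K \<subseteq> (\<lambda>x. r *\<^sub>R x) ` K)"
    by (simp add: s_def john_asymmetry_def)
  then have s: "0 < s" "- x /\<^sub>R s \<in> K"
    using reflection_ratio_attained[OF K(1,2) sub] \<open>e \<in> K\<close> \<open>e \<noteq> 0\<close> x(1) by auto
  have "\<rho>\<^sup>2 \<le> s * real CARD('n)"
    using norm_power2_le_of_max[OF compact_imp_closed[OF K(1)] K(2) assms(3) x(1) _ s] \<open>1 \<le> \<rho>\<close> x(2)
    by simp
  then have "\<rho> \<le> sqrt (s * real CARD('n))"
    by (rule real_le_rsqrt)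
  moreover have "minkowski_asymmetry K \<le> \<rho>"
    using minkowski_asymmetry_le_radius[OF sub _ x(3)] \<open>1 \<le> \<rho>\<close> by simp
  ultimately show ?thesis
    by (simp add: s_def)
qed

end
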